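(* Suppose $f:\mathbb{R}^{m\times n}\to\mathbb{R}$ is twice continuously differentiable on $\mathbb{R}^{m\times n}$. Let $X\in\mathcal{L}\cap\mathbb{R}(r)$ be an $F$-stationary point of the problem (rank-MOA) of minimizing $f$ over $\mathcal{L}\cap\mathbb{R}(r)$, with a fixed singular value decomposition $X=U\Sigma(X)V^\top$, and let $s=\mathrm{rank}(X)$. Suppose that $$[\nabla^2f(X)](\Xi,\Xi)>0\qquad\forall\,\Xi\in\left(\mathrm{T}_{\mathcal{L}}(X)\cap\mathrm{T}^B_{\mathbb{R}(r)}(X)\right)\setminus\{0\},$$ where $\nabla^2f(X)$ is the Hessian of $f$ at $X$ (as a bilinear form). Then: (i) If $s=r$, then $X$ is a strict local minimizer of (rank-MOA) restricted on $\mathbb{R}_X(r)$, i.e. a strict local minimizer of $f$ over $\mathcal{L}\cap\mathbb{R}_X(r)$. (ii) If $s<r$, then $X$ is a strict local minimizer of (rank-MOA).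
   Context: Let $m\ge n$ and $1\le r<n$ be integers. $\mathbb{R}^{m\times n}$ carries the inner product $\langle X,Y\rangle=\sum_{ij}X_{ij}Y_{ij}$. Given $A^1,\dots,A^l\in\mathbb{R}^{m\times n}$ and $b_1,\dots,b_l\in\mathbb{R}$, set $\mathcal{L}=\{X\in\mathbb{R}^{m\times n}:\langle A^i,X\rangle=b_i,\ i=1,\dots,l\}$ and $\mathbb{R}(r)=\{X\in\mathbb{R}^{m\times n}:\mathrm{rank}(X)\le r\}$. Cones. The polar of a cone $\mathcal{K}$ is $\mathcal{K}^\circ=\{Y:\langle Y,X\rangle\le 0\ \forall X\in\mathcal{K}\}$. For a nonempty closed set $\Omega\subseteq\mathbb{R}^{m\times n}$ and $X\in\Omega$, the Bouligand tangent cone $\mathrm{T}^B_\Omega(X)$ is the set of all $\Xi$ for which there are $X^k\in\Omega$ with $X^k\to X$ and $t_k>0$ with $t_k\to0$ such that $t_k^{-1}(X^k-X)\to\Xi$; the Fréchet normal cone is $\mathrm{N}^F_\Omega(X)=[\mathrm{T}^B_\Omega(X)]^\circ$. For the affine set $\mathcal{L}$ one writes $\mathrm{T}_{\mathcal{L}}(X)=\mathrm{T}^B_{\mathcal{L}}(X)$. For $X\in\mathbb{R}^{m\times n}$ of rank $s$ fix an SVD $X=U\Sigma(X)V^\top$, with $U\in\mathbb{R}^{m\times m}$, $V\in\mathbb{R}^{n\times n}$ orthogonal and $\Sigma(X)$ the (rectangular) diagonal $m\times n$ matrix of singular values; $\Gamma\subseteq\{1,\dots,n\}$, $|\Gamma|=s$,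 is the index set of the nonzero singular values. For an index set $J$, $U_J$ (resp. $V_J$) is the submatrix of columns of $U$ (resp. $V$) indexed by $J$. Let $\mathcal{J}=\{J\subseteq\{1,\dots,n\}:|J|=r,\ \Gamma\subseteq J\}$, $\mathbb{R}_X(J)=\{U_JAV_J^\top:A\in\mathbb{R}^{r\times r}\}$ for $J\in\mathcal{J}$, and $\mathbb{R}_X(r)=\bigcup_{J\in\mathcal{J}}\mathbb{R}_X(J)\subseteq\mathbb{R}(r)$ (these depend on the chosen $U,V$). The Lagrangian is $L(X,y)=f(X)+\sum_{i=1}^l y_i(\langle A^i,X\rangle-b_i)$, so $\nabla_XL(X,y)=\nabla f(X)+\sum_i y_iA^i$. A matrix $X\in\mathbb{R}(r)$ is an $F$-stationary point of (rank-MOA) if there is $y\in\mathbb{R}^l$ with $\langle A^i,X\rangle=b_i$ for all $i$ and $-\nabla_XL(X,y)\in\mathrm{N}^F_{\mathbb{R}(r)}(X)$. *)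

theory Defs
  imports "HOL-Analysis.Analysis"
begin

(* An m x n matrix has type real^'n^'m with m = CARD('m), n = CARD('n).  The inner
   product of this type is the Frobenius one, and its norm is the Frobenius norm. *)

definition gradient :: "('a::euclidean_space \<Rightarrow> real) \<Rightarrow> 'a \<Rightarrow> 'a" where
  "gradient f x = (THE D. GDERIV f x :> D)"

definition hessian :: "('a::euclidean_space \<Rightarrow> real) \<Rightarrow> 'a \<Rightarrow> 'a \<Rightarrow> 'a \<Rightarrow> real" where
  "hessian f x u v = frechet_derivative (gradient f) (at x) u \<bullet> v"

(* H x is the second derivative of f at x; its continuity is in the operator norm. *)
definition twice_continuously_differentiable :: "('a::euclidean_space \<Rightarrow> real) \<Rightarrow> bool" where
  "twice_continuously_differentiable f \<longleftrightarrow>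
     (\<forall>x. f differentiable (at x)) \<and>
     (\<exists>H :: 'a \<Rightarrow> ('a \<Rightarrow>\<^sub>L 'a).
        (\<forall>x. (gradient f has_derivative blinfun_apply (H x)) (at x)) \<and> continuous_on UNIV H)"

definition strict_local_minimizer ::
    "('a::metric_space \<Rightarrow> real) \<Rightarrow> 'a set \<Rightarrow> 'a \<Rightarrow> bool" where
  "strict_local_minimizer f S x \<longleftrightarrow>
     x \<in> S \<and> (\<exists>e>0. \<forall>z\<in>S. z \<noteq> x \<and> dist z x < e \<longrightarrow> f x < f z)"

definition polar_cone :: "'a::real_inner set \<Rightarrow> 'a set" where
  "polar_cone K = {y. \<forall>x\<in>K. y \<bullet> x \<le> 0}"

definition bouligand_tangent_cone :: "'a::real_normed_vector set \<Rightarrow> 'a \<Rightarrow> 'a set" where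
  "bouligand_tangent_cone S x =
     {d. \<exists>(z :: nat \<Rightarrow> 'a) (t :: nat \<Rightarrow> real).
           (\<forall>k. z k \<in> S) \<and> z \<longlonglongrightarrow> x \<and> (\<forall>k. t k > 0) \<and> t \<longlonglongrightarrow> 0 \<and>
           (\<lambda>k. inverse (t k) *\<^sub>R (z k - x)) \<longlonglongrightarrow> d}"

definition frechet_normal_cone :: "'a::real_inner set \<Rightarrow> 'a \<Rightarrow> 'a set" where
  "frechet_normal_cone S x = polar_cone (bouligand_tangent_cone S x)"

(* The data (A i, b i) matters only for i in {1..l}. *)
definition affine_constraints ::
    "nat \<Rightarrow> (nat \<Rightarrow> real^'n^'m) \<Rightarrow> (nat \<Rightarrow> real) \<Rightarrow> (real^'n^'m) set" where
  "affine_constraints l A b = {X. \<forall>i\<in>{1..l}. A i \<bullet> X = b i}"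

definition low_rank_matrices :: "nat \<Rightarrow> (real^'n^'m) set" where
  "low_rank_matrices r = {X. rank X \<le> r}"

definition lagrangian ::
    "(real^'n^'m \<Rightarrow> real) \<Rightarrow> nat \<Rightarrow> (nat \<Rightarrow> real^'n^'m) \<Rightarrow> (nat \<Rightarrow> real) \<Rightarrow>
     real^'n^'m \<Rightarrow> (nat \<Rightarrow> real) \<Rightarrow> real" where
  "lagrangian f l A b X y = f X + (\<Sum>i=1..l. y i * (A i \<bullet> X - b i))"

definition F_stationary ::
    "(real^'n^'m \<Rightarrow> real) \<Rightarrow> nat \<Rightarrow> (nat \<Rightarrow> real^'n^'m) \<Rightarrow> (nat \<Rightarrow> real) \<Rightarrow> nat \<Rightarrow>
     real^'n^'m \<Rightarrow> bool" where
  "F_stationary f l A b r X \<longleftrightarrow>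
     X \<in> low_rank_matrices r \<and>
     (\<exists>y. (\<forall>i\<in>{1..l}. A i \<bullet> X = b i) \<and>
          - gradient (\<lambda>Z. lagrangian f l A b Z y) X
            \<in> frechet_normal_cone (low_rank_matrices r) X)"

(* The injection \<iota> plays the role of the inclusion {1..n} <= {1..m}: it says which
   row index carries the j-th diagonal entry, and so which column of U belongs to j. *)
definition rect_diag :: "('n \<Rightarrow> 'm) \<Rightarrow> ('n \<Rightarrow> real) \<Rightarrow> real^'n^'m" where
  "rect_diag \<iota> \<sigma> = (\<chi> i j. if i = \<iota> j then \<sigma> j else 0)"

(* The singular values \<sigma> are not required to be listed in decreasing order. *)
definition is_svd ::
    "('n \<Rightarrow> 'm) \<Rightarrow> real^'m^'m \<Rightarrow> ('n \<Rightarrow> real) \<Rightarrow> real^'n^'n \<Rightarrow> real^'n^'m \<Rightarrow> bool" where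
  "is_svd \<iota> U \<sigma> V X \<longleftrightarrow>
     inj \<iota> \<and> orthogonal_matrix U \<and> orthogonal_matrix V \<and> (\<forall>j. 0 \<le> \<sigma> j) \<and>
     X = U ** rect_diag \<iota> \<sigma> ** transpose V"

(* {U_J A V_J^T}: the square matrix A of size |J| has its rows and columns indexed by J
   itself, and only its entries A i j with i, j in J matter. *)
definition RXJ ::
    "('n \<Rightarrow> 'm) \<Rightarrow> real^'m^'m \<Rightarrow> real^'n^'n \<Rightarrow> 'n set \<Rightarrow> (real^'n^'m) set" where
  "RXJ \<iota> U V J =
     {Z. \<exists>A :: 'n \<Rightarrow> 'n \<Rightarrow> real.
           Z = (\<chi> p q. \<Sum>i\<in>J. \<Sum>j\<in>J. U $ p $ \<iota> i * A i j * V $ q $ j)}"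

definition RX ::
    "('n \<Rightarrow> 'm) \<Rightarrow> real^'m^'m \<Rightarrow> ('n \<Rightarrow> real) \<Rightarrow> real^'n^'n \<Rightarrow> nat \<Rightarrow> (real^'n^'m) set" where
  "RX \<iota> U \<sigma> V r = (\<Union>J\<in>{J. card J = r \<and> {j. \<sigma> j \<noteq> 0} \<subseteq> J}. RXJ \<iota> U V J)"

end

theory Submission
  imports Defs
begin

text \<open>
  If \<open>f z \<le> f x\<close> along feasible \<open>z \<rightarrow> x\<close>, a unit tangent direction \<open>d\<close> arises as a limit of
  normalized steps. When the gradient at \<open>x\<close> is nonnegative on all feasible steps, the second-order
  expansion forces the Hessian to be nonpositive at \<open>d\<close>, against the hypothesis. The gradient of the
  Lagrangian differs from that of \<open>f\<close> by a vector orthogonal to the affine constraint set, so it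
  remains to check the sign condition for the Lagrangian. If \<open>rank X < r\<close>, then \<open>X\<close> can be moved
  along any matrix with one nonzero entry without leaving the rank constraint set, so the normal cone
  is trivial and the gradient of the Lagrangian vanishes. If \<open>rank X = r\<close>, each piece of
  \<open>RX\<close> is a linear space of matrices of rank at most \<open>r\<close> through \<open>X\<close>, hence steps inside it are
  tangent directions of the rank constraint set.
\<close>

section \<open>Tangent cones\<close>

lemma bouligand_tangent_cone_mono:
  "S \<subseteq> T \<Longrightarrow> bouligand_tangent_cone S x \<subseteq> bouligand_tangent_cone T x"
  unfolding bouligand_tangent_cone_def by blast

lemma bouligand_tangent_cone_ray:
  fixes x d :: "'a::real_normed_vector"
  assumes "\<And>t. 0 < t \<Longrightarrow> x + t *\<^sub>R d \<in> S"
  shows "d \<in> bouligand_tangent_cone S x"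
proof -
  define t where "t k = inverse (real (Suc k))" for k
  have t0: "t \<longlonglongrightarrow> 0"
    unfolding t_def by (rule LIMSEQ_inverse_real_of_nat)
  have pos: "t k > 0" for k
    by (simp add: t_def)
  have "(\<lambda>k. x + t k *\<^sub>R d) \<longlonglongrightarrow> x + 0 *\<^sub>R d"
    by (intro tendsto_intros t0)
  moreover have "inverse (t k) *\<^sub>R (x + t k *\<^sub>R d - x) = d" for k
    using pos[of k] by simp
  ultimately show ?thesis
    unfolding bouligand_tangent_cone_def mem_Collect_eq
    by (intro exI[of _ "\<lambda>k. x + t k *\<^sub>R d"] exI[of _ t]) (simp add: assms pos t0)
qed

section \<open>Gradients and the second-order sufficient condition\<close>

lemma gradient_eqI:
  assumes "(f has_derivative (\<lambda>h. h \<bullet> D)) (at x)"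
  shows "gradient f x = D"
  unfolding gradient_def
proof (rule the_equality)
  show "GDERIV f x :> D"
    using assms by (simp add: gderiv_def)
  fix D' assume "GDERIV f x :> D'"
  then have "(\<lambda>h. h \<bullet> D') = (\<lambda>h. h \<bullet> D)"
    using assms has_derivative_unique unfolding gderiv_def by blast
  then show "D' = D"
    by (metis vector_eq_ldot)
qed

text \<open>Makes the definite description in \<open>gradient\<close> usable: the derivative is
  represented by a vector built on the orthonormal basis, as in the Riesz theorem.\<close>

lemma has_derivative_gradient:
  fixes f :: "'a::euclidean_space \<Rightarrow> real"
  assumes "f differentiable (at x)"
  shows "(f has_derivative (\<lambda>h. h \<bullet> gradient f x)) (at x)"
proof -
  obtain f' where f': "(f has_derivative f') (at x)"
    using assms by (auto simp: differentiable_def)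
  then have lin: "linear f'"
    by (rule has_derivative_linear)
  define D where "D = (\<Sum>b\<in>Basis. f' b *\<^sub>R b)"
  have "f' h = h \<bullet> D" for h
  proof -
    have "f' h = f' (\<Sum>b\<in>Basis. (h \<bullet> b) *\<^sub>R b)"
      by (simp add: euclidean_representation)
    also have "\<dots> = h \<bullet> D"
      by (simp add: D_def inner_sum_right linear_sum[OF lin] linear_cmul[OF lin] mult.commute)
    finally show ?thesis .
  qed
  then have D: "(f has_derivative (\<lambda>h. h \<bullet> D)) (at x)"
    using f' by (metis ext)
  then show ?thesis
    using gradient_eqI[OF D] by simp
qed

text \<open>By the mean value theorem, the gradient at some interior point of the segment has
  nonpositive inner product with the step \<open>h\<close>. Differentiability of \<open>G\<close> at
  \<open>x\<close> replaces it by \<open>G x + \<theta> *\<^sub>R H h\<close> up to an error of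
  \<open>e * (\<theta> * norm h)\<close>; dropping \<open>G x \<bullet> h\<close> by its sign and
  cancelling \<open>\<theta>\<close> leaves the bound.\<close>

lemma second_order_decrease:
  fixes f :: "'a::euclidean_space \<Rightarrow> real"
  assumes f: "\<And>z. (f has_derivative (\<lambda>h. h \<bullet> G z)) (at z)"
    and G: "(G has_derivative H) (at x)" and "0 < e"
  obtains d where "0 < d"
    and "\<And>z. \<lbrakk>z \<noteq> x; dist z x < d; f z \<le> f x; 0 \<le> G x \<bullet> (z - x)\<rbrakk>
           \<Longrightarrow> H (sgn (z - x)) \<bullet> sgn (z - x) \<le> e"
proof -
  interpret H: bounded_linear H
    using G by (rule has_derivative_bounded_linear)
  obtain d where "0 < d"
    and d: "\<And>y. norm (y - x) < d \<Longrightarrow> norm (G y - G x - H (y - x)) \<le> e * norm (y - x)"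
    using G \<open>0 < e\<close> unfolding has_derivative_at_alt by blast
  have "H (sgn (z - x)) \<bullet> sgn (z - x) \<le> e"
    if "z \<noteq> x" "dist z x < d" and le: "f z \<le> f x" and ge: "0 \<le> G x \<bullet> (z - x)" for z
  proof -
    define h where "h = z - x"
    have h: "h \<noteq> 0" "norm h < d"
      using that by (auto simp: h_def dist_norm)
    have "((\<lambda>t. f (x + t *\<^sub>R h)) has_derivative (\<lambda>s. (s *\<^sub>R h) \<bullet> G (x + t *\<^sub>R h))) (at t)" for t
      by (rule has_derivative_compose[OF _ f]) (auto intro!: derivative_eq_intros)
    then have "\<exists>\<theta>\<in>{0<..<1}. f (x + 1 *\<^sub>R h) - f (x + 0 *\<^sub>R h) = ((1 - 0) *\<^sub>R h) \<bullet> G (x + \<theta> *\<^sub>R h)"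
      by (intro mvt_simple) (auto intro: has_derivative_at_withinI)
    then obtain \<theta> where \<theta>: "0 < \<theta>" "\<theta> < 1"
      and eq: "f (x + 1 *\<^sub>R h) - f (x + 0 *\<^sub>R h) = ((1 - 0) *\<^sub>R h) \<bullet> G (x + \<theta> *\<^sub>R h)"
      by auto
    have neg: "G (x + \<theta> *\<^sub>R h) \<bullet> h \<le> 0"
      using eq le by (simp add: h_def inner_commute)
    define R where "R = G (x + \<theta> *\<^sub>R h) - G x - H (\<theta> *\<^sub>R h)"
    \<comment> \<open>As \<open>\<theta> < 1\<close>, the intermediate point stays in the ball where
      the remainder estimate holds.\<close>
    have "norm (\<theta> *\<^sub>R h) < d"
      using \<theta> h mult_strict_mono'[of \<theta> 1 "norm h" d] by simp
    then have "norm R \<le> e * (\<theta> * norm h)"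
      using d[of "x + \<theta> *\<^sub>R h"] \<theta> by (simp add: R_def)
    then have "norm R * norm h \<le> \<theta> * (e * (norm h)\<^sup>2)"
      using mult_right_mono[of "norm R" "e * (\<theta> * norm h)" "norm h"]
      by (simp add: power2_eq_square mult_ac)
    then have R: "- (\<theta> * (e * (norm h)\<^sup>2)) \<le> R \<bullet> h"
      using Cauchy_Schwarz_ineq2[of R h] by linarith
    have "G (x + \<theta> *\<^sub>R h) = G x + \<theta> *\<^sub>R H h + R"
      by (simp add: R_def H.scaleR)
    then have "G (x + \<theta> *\<^sub>R h) \<bullet> h = G x \<bullet> h + \<theta> * (H h \<bullet> h) + R \<bullet> h"
      by (simp add: inner_add_left)
    then have "\<theta> * (H h \<bullet> h) \<le> \<theta> * (e * (norm h)\<^sup>2)"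
      using R neg ge by (simp add: h_def)
    then have "H h \<bullet> h \<le> e * (norm h)\<^sup>2"
      using \<theta> by simp
    moreover have "H (sgn h) \<bullet> sgn h = (H h \<bullet> h) / (norm h)\<^sup>2"
      by (simp add: sgn_div_norm H.scaleR power2_eq_square divide_inverse)
    ultimately show ?thesis
      using h by (simp add: h_def[symmetric] divide_le_eq)
  qed
  with \<open>0 < d\<close> show thesis
    by (rule that)
qed

text \<open>The first-order hypothesis is a sign on \<open>S\<close> instead of
  \<open>G x = 0\<close>: with constraints, \<open>G x\<close> itself may be nonzero, and only its
  product with feasible steps is controlled.\<close>

lemma second_order_sufficient:
  fixes f :: "'a::euclidean_space \<Rightarrow> real"
  assumes f: "\<And>z. (f has_derivative (\<lambda>h. h \<bullet> G z)) (at z)"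
    and G: "(G has_derivative H) (at x)"
    and "x \<in> S" and ge: "\<And>z. z \<in> S \<Longrightarrow> 0 \<le> G x \<bullet> (z - x)"
    and pos: "\<And>d. \<lbrakk>d \<in> bouligand_tangent_cone S x; d \<noteq> 0\<rbrakk> \<Longrightarrow> 0 < H d \<bullet> d"
  shows "strict_local_minimizer f S x"
proof (rule ccontr)
  assume "\<not> strict_local_minimizer f S x"
  have *: "\<exists>z\<in>S. z \<noteq> x \<and> dist z x < e \<and> f z \<le> f x" if "0 < e" for e
  proof (rule ccontr)
    assume "\<not> ?thesis"
    then have "\<forall>z\<in>S. z \<noteq> x \<and> dist z x < e \<longrightarrow> f x < f z"
      by (auto simp: not_le)
    with \<open>\<not> strict_local_minimizer f S x\<close> \<open>x \<in> S\<close> that show False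
      unfolding strict_local_minimizer_def by blast
  qed
  have "\<forall>k. \<exists>z. z \<in> S \<and> z \<noteq> x \<and> dist z x < inverse (real (Suc k)) \<and> f z \<le> f x"
    using * by (simp add: Bex_def del: of_nat_Suc)
  from choice[OF this] obtain z where z: "\<And>k. z k \<in> S" "\<And>k. z k \<noteq> x" "\<And>k. f (z k) \<le> f x"
    and dist: "\<And>k. dist (z k) x < inverse (real (Suc k))"
    by blast
  have "(\<lambda>k. dist (z k) x) \<longlonglongrightarrow> 0"
    by (rule tendsto_sandwich[OF _ _ tendsto_const LIMSEQ_inverse_real_of_nat])
      (simp_all add: less_imp_le[OF dist] del: of_nat_Suc)
  then have lim: "z \<longlonglongrightarrow> x"
    by (rule iffD2[OF tendsto_dist_iff])
  \<comment> \<open>Compactness of the unit sphere supplies a limit direction, which is nonzero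
    because its norm is \<open>1\<close>.\<close>
  have "\<forall>k. sgn (z k - x) \<in> sphere 0 1"
    using z by (simp add: norm_sgn)
  then obtain d \<phi> where d: "d \<in> sphere 0 1" and \<phi>: "strict_mono (\<phi> :: nat \<Rightarrow> nat)"
    and limd: "((\<lambda>k. sgn (z k - x)) \<circ> \<phi>) \<longlonglongrightarrow> d"
    using compact_sphere[of "0::'a" 1] unfolding compact_def by meson
  have limz: "(z \<circ> \<phi>) \<longlonglongrightarrow> x"
    using lim \<phi> by (rule LIMSEQ_subseq_LIMSEQ)
  have "(\<lambda>k. norm ((z \<circ> \<phi>) k - x)) \<longlonglongrightarrow> 0"
    using limz by (intro tendsto_norm_zero LIM_zero)
  \<comment> \<open>The step sizes are the distances to \<open>x\<close>, so the difference
    quotients are exactly the normalized steps.\<close>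
  then have "d \<in> bouligand_tangent_cone S x"
    unfolding bouligand_tangent_cone_def mem_Collect_eq
    using z limz limd
    by (intro exI[of _ "z \<circ> \<phi>"] exI[of _ "\<lambda>k. norm ((z \<circ> \<phi>) k - x)"])
      (simp add: sgn_div_norm o_def divide_inverse)
  then have "0 < H d \<bullet> d"
    using d by (intro pos) auto
  moreover have "H d \<bullet> d \<le> e" if e: "0 < e" for e
  proof -
    obtain \<delta> where "0 < \<delta>"
      and \<delta>: "\<And>z. \<lbrakk>z \<noteq> x; dist z x < \<delta>; f z \<le> f x; 0 \<le> G x \<bullet> (z - x)\<rbrakk>
               \<Longrightarrow> H (sgn (z - x)) \<bullet> sgn (z - x) \<le> e"
      using second_order_decrease[OF f G e] by blast
    have "\<forall>\<^sub>F k in sequentially. dist ((z \<circ> \<phi>) k) x < \<delta>"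
      using limz \<open>0 < \<delta>\<close> by (rule tendstoD)
    then have "\<forall>\<^sub>F k in sequentially. H (((\<lambda>k. sgn (z k - x)) \<circ> \<phi>) k) \<bullet> ((\<lambda>k. sgn (z k - x)) \<circ> \<phi>) k \<le> e"
      by eventually_elim (simp add: \<delta> z ge)
    moreover have "(\<lambda>k. H (((\<lambda>k. sgn (z k - x)) \<circ> \<phi>) k) \<bullet> ((\<lambda>k. sgn (z k - x)) \<circ> \<phi>) k)
                     \<longlonglongrightarrow> H d \<bullet> d"
      by (intro tendsto_inner limd bounded_linear.tendsto[OF has_derivative_bounded_linear[OF G]])
    ultimately show ?thesis
      by (metis tendsto_upperbound sequentially_bot)
  qed
  \<comment> \<open>Any \<open>e\<close> strictly between \<open>0\<close> and
    \<open>H d \<bullet> d\<close> gives the contradiction.\<close>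
  ultimately show False
    by (metis dense not_le)
qed

section \<open>Rank bounds and the normal cone at points of rank below \<open>r\<close>\<close>

lemma rank_add_le: "rank (B + C) \<le> rank B + rank C"
  for B C :: "real^'n^'m"
proof -
  let ?R = "\<lambda>M :: real^'n^'m. range ((*v) M)"
  have sub: "subspace (?R M)" for M
    by (rule linear_subspace_image[OF matrix_vector_mul_linear subspace_UNIV])
  have "?R (B + C) \<subseteq> {x + y |x y. x \<in> ?R B \<and> y \<in> ?R C}"
    by (auto simp: matrix_vector_mult_add_rdistrib)
  then have "dim (?R (B + C)) \<le> dim {x + y |x y. x \<in> ?R B \<and> y \<in> ?R C}"
    by (rule dim_subset)
  also have "\<dots> \<le> dim (?R B) + dim (?R C)"
    using dim_sums_Int[OF sub[of B] sub[of C]] by simp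
  finally show ?thesis
    by (simp add: rank_dim_range)
qed

lemma rank_le_card:
  fixes M :: "real^'n^'m"
  assumes "finite B" and "\<And>j. column j M \<in> span B"
  shows "rank M \<le> card B"
  unfolding column_rank_def
  using assms by (intro dim_le_card) (auto simp: columns_def)

lemma frechet_normal_cone_low_rank_matrices:
  fixes X N :: "real^'n^'m"
  assumes "rank X < r" and N: "N \<in> frechet_normal_cone (low_rank_matrices r) X"
  shows "N = 0"
proof -
  have tan: "axis i (axis j c) \<in> bouligand_tangent_cone (low_rank_matrices r) X" for i j c
  proof (rule bouligand_tangent_cone_ray)
    fix t :: real
    let ?W = "t *\<^sub>R axis i (axis j c) :: real^'n^'m"
    \<comment> \<open>All columns are multiples of one vector, so the perturbation has rank at most
      one, which \<open>rank X < r\<close> leaves room for.\<close>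
    have "column k ?W = (if k = j then t * c else 0) *\<^sub>R axis i 1" for k
      by (simp add: vec_eq_iff column_def axis_def)
    then have "column k ?W \<in> span {axis i 1}" for k
      by (metis span_base span_scale insertI1)
    then have "rank ?W \<le> card {axis i 1 :: real^'m}"
      by (intro rank_le_card) auto
    then show "X + ?W \<in> low_rank_matrices r"
      using rank_add_le[of X ?W] \<open>rank X < r\<close> by (simp add: low_rank_matrices_def)
  qed
  have "N $ i $ j * c \<le> 0" for i j c
    using N tan[of i j c]
    by (auto simp: frechet_normal_cone_def polar_cone_def inner_axis dest!: bspec)
  \<comment> \<open>Opposite signs of \<open>c\<close> bound every entry of \<open>N\<close> by zero
    from above and from below.\<close>
  from this[of _ _ 1] this[of _ _ "-1"] show ?thesis
    by (simp add: vec_eq_iff antisym)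
qed

section \<open>The pieces of \<open>RX\<close> and the singular value decomposition\<close>

lemma subspace_RXJ: "subspace (RXJ \<iota> U V J)"
proof (rule subspaceI)
  show "0 \<in> RXJ \<iota> U V J"
    unfolding RXJ_def by (auto simp: vec_eq_iff intro!: exI[of _ "\<lambda>_ _. 0"])
next
  fix Y Z assume "Y \<in> RXJ \<iota> U V J" "Z \<in> RXJ \<iota> U V J"
  then obtain B C where
    "Y = (\<chi> p q. \<Sum>i\<in>J. \<Sum>j\<in>J. U $ p $ \<iota> i * B i j * V $ q $ j)"
    "Z = (\<chi> p q. \<Sum>i\<in>J. \<Sum>j\<in>J. U $ p $ \<iota> i * C i j * V $ q $ j)"
    unfolding RXJ_def by blast
  then show "Y + Z \<in> RXJ \<iota> U V J"
    unfolding RXJ_def mem_Collect_eq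
    by (intro exI[of _ "\<lambda>i j. B i j + C i j"])
      (simp add: vec_eq_iff algebra_simps sum.distrib)
next
  fix c Y assume "Y \<in> RXJ \<iota> U V J"
  then obtain B where "Y = (\<chi> p q. \<Sum>i\<in>J. \<Sum>j\<in>J. U $ p $ \<iota> i * B i j * V $ q $ j)"
    unfolding RXJ_def by blast
  then show "c *\<^sub>R Y \<in> RXJ \<iota> U V J"
    unfolding RXJ_def mem_Collect_eq
    by (intro exI[of _ "\<lambda>i j. c * B i j"]) (simp add: vec_eq_iff sum_distrib_left mult_ac)
qed

text \<open>Each column of \<open>Z\<close> is a combination of the vectors
  \<open>column (\<iota> i) U\<close> with \<open>i\<close> in \<open>J\<close>.\<close>

lemma rank_RXJ_le:
  fixes \<iota> :: "'n::finite \<Rightarrow> 'm::finite" and Z :: "real^'n^'m"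
  assumes "Z \<in> RXJ \<iota> U V J"
  shows "rank Z \<le> card J"
proof -
  obtain B where Z: "Z = (\<chi> p q. \<Sum>i\<in>J. \<Sum>j\<in>J. U $ p $ \<iota> i * B i j * V $ q $ j)"
    using assms unfolding RXJ_def by blast
  have "column q Z = (\<Sum>i\<in>J. (\<Sum>j\<in>J. B i j * V $ q $ j) *\<^sub>R column (\<iota> i) U)" for q
    by (simp add: Z vec_eq_iff column_def sum_distrib_left sum_distrib_right mult_ac)
  then have "column q Z \<in> span ((\<lambda>i. column (\<iota> i) U) ` J)" for q
    by (simp, intro span_sum span_scale span_base imageI)
  then have "rank Z \<le> card ((\<lambda>i. column (\<iota> i) U) ` J)"
    by (intro rank_le_card) auto
  also have "\<dots> \<le> card J"
    by (rule card_image_le) simp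
  finally show ?thesis .
qed

text \<open>The coefficient matrix is the diagonal matrix of \<open>\<sigma>\<close>; indices
  outside \<open>J\<close> contribute nothing to the product, since \<open>\<sigma>\<close> vanishes
  there.\<close>

lemma svd_in_RXJ:
  assumes svd: "is_svd \<iota> U \<sigma> V X" and J: "{j. \<sigma> j \<noteq> 0} \<subseteq> J"
  shows "X \<in> RXJ \<iota> U V J"
proof -
  have "X $ p $ q = (\<Sum>i\<in>J. \<Sum>j\<in>J. U $ p $ \<iota> i * (if i = j then \<sigma> i else 0) * V $ q $ j)" for p q
  proof -
    have "X = U ** rect_diag \<iota> \<sigma> ** transpose V"
      using svd by (simp add: is_svd_def)
    then have "X $ p $ q = (\<Sum>k\<in>UNIV. U $ p $ \<iota> k * \<sigma> k * V $ q $ k)"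
      by (simp add: matrix_matrix_mult_def rect_diag_def transpose_def if_distrib
          cong: if_cong)
    also have "\<dots> = (\<Sum>k\<in>J. U $ p $ \<iota> k * \<sigma> k * V $ q $ k)"
      using J by (intro sum.mono_neutral_right) auto
    also have "\<dots> = (\<Sum>i\<in>J. \<Sum>j\<in>J. U $ p $ \<iota> i * (if i = j then \<sigma> i else 0) * V $ q $ j)"
      by (simp add: if_distrib if_distribR cong: if_cong)
    finally show ?thesis .
  qed
  then show ?thesis
    unfolding RXJ_def mem_Collect_eq
    by (intro exI[of _ "\<lambda>i j. if i = j then \<sigma> i else 0"]) (simp add: vec_eq_iff)
qed

text \<open>Ensures that the support of \<open>\<sigma>\<close> fits into an index set of size
  \<open>r\<close> when \<open>rank X = r\<close>. Orthogonality expresses the diagonal factor as a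
  product containing \<open>X\<close>, and its range contains a distinct axis vector for each
  nonzero \<open>\<sigma> j\<close>.\<close>

lemma svd_card_le_rank:
  fixes \<iota> :: "'n::finite \<Rightarrow> 'm::finite" and X :: "real^'n^'m"
  assumes "is_svd \<iota> U \<sigma> V X"
  shows "card {j. \<sigma> j \<noteq> 0} \<le> rank X"
proof -
  let ?D = "rect_diag \<iota> \<sigma>" and ?B = "(\<lambda>j. axis (\<iota> j) 1 :: real^'m) ` {j. \<sigma> j \<noteq> 0}"
  have inj: "inj \<iota>" and U: "transpose U ** U = mat 1" and V: "transpose V ** V = mat 1"
    and X: "X = U ** ?D ** transpose V"
    using assms by (auto simp: is_svd_def orthogonal_matrix)
  have "transpose U ** X ** V = (transpose U ** U) ** ?D ** (transpose V ** V)"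
    by (simp only: X matrix_mul_assoc)
  then have "?D = transpose U ** X ** V"
    by (simp add: U V)
  then have "rank ?D \<le> rank X"
    by (metis order_trans rank_mul_le_left rank_mul_le_right)
  moreover have "axis (\<iota> j) 1 = ?D *v axis j (1 / \<sigma> j)" if "\<sigma> j \<noteq> 0" for j
  proof -
    have "(?D *v axis j (1 / \<sigma> j)) $ i = ?D $ i $ j / \<sigma> j" for i
      by (simp add: matrix_vector_mult_def axis_def if_distrib cong: if_cong)
    then show ?thesis
      using that by (simp add: vec_eq_iff rect_diag_def axis_def)
  qed
  then have "?B \<subseteq> range ((*v) ?D)"
    by blast
  moreover have "independent ?B"
    by (rule independent_mono[OF independent_Basis]) (auto simp: Basis_vec_def)
  ultimately have "card ?B \<le> rank X"
    using independent_card_le_dim[of ?B "range ((*v) ?D)"] by (simp add: rank_dim_range)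
  moreover have "inj_on (\<lambda>j. axis (\<iota> j) 1 :: real^'m) {j. \<sigma> j \<noteq> 0}"
    using inj by (auto simp: inj_on_def axis_eq_axis)
  ultimately show ?thesis
    by (simp add: card_image)
qed

section \<open>The Lagrangian and the two rank cases\<close>

lemma gradient_lagrangian:
  assumes "f differentiable (at X)"
  shows "gradient (\<lambda>Z. lagrangian f l A b Z y) X = gradient f X + (\<Sum>i=1..l. y i *\<^sub>R A i)"
  unfolding lagrangian_def
  by (rule gradient_eqI)
    (auto intro!: derivative_eq_intros has_derivative_gradient[OF assms]
      simp: inner_add_right inner_sum_right inner_commute fun_eq_iff)

theorem theorem3p4:
  fixes f :: "real^'n^'m \<Rightarrow> real"
    and A :: "nat \<Rightarrow> real^'n^'m" and b :: "nat \<Rightarrow> real" and l r :: nat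
    and X :: "real^'n^'m"
    and \<iota> :: "'n \<Rightarrow> 'm" and U :: "real^'m^'m" and \<sigma> :: "'n \<Rightarrow> real" and V :: "real^'n^'n"
  assumes "CARD('n) \<le> CARD('m)" and "1 \<le> r" and "r < CARD('n)"
    and "twice_continuously_differentiable f"
    and "X \<in> affine_constraints l A b \<inter> low_rank_matrices r"
    and "F_stationary f l A b r X"
    and "is_svd \<iota> U \<sigma> V X"
    and "\<forall>\<Xi> \<in> (bouligand_tangent_cone (affine_constraints l A b) X \<inter>
               bouligand_tangent_cone (low_rank_matrices r) X) - {0}. hessian f X \<Xi> \<Xi> > 0"
  shows "(rank X = r \<longrightarrow>
            strict_local_minimizer f (affine_constraints l A b \<inter> RX \<iota> U \<sigma> V r) X) \<and>
         (rank X < r \<longrightarrow>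
            strict_local_minimizer f (affine_constraints l A b \<inter> low_rank_matrices r) X)"
proof (intro conjI impI)
  obtain H where diff: "\<And>Z. f differentiable (at Z)"
    and H: "(gradient f has_derivative blinfun_apply (H X)) (at X)"
    using assms(4) unfolding twice_continuously_differentiable_def by blast
  have hess: "hessian f X \<Xi> \<Xi> = H X \<Xi> \<bullet> \<Xi>" for \<Xi>
    by (simp add: hessian_def frechet_derivative_at[OF H, symmetric])
  obtain y where "- gradient (\<lambda>Z. lagrangian f l A b Z y) X
                    \<in> frechet_normal_cone (low_rank_matrices r) X"
    using assms(6) unfolding F_stationary_def by blast
  then have normal: "- (gradient f X + (\<Sum>i=1..l. y i *\<^sub>R A i))
                       \<in> frechet_normal_cone (low_rank_matrices r) X"
    by (simp add: gradient_lagrangian[OF diff])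
  \<comment> \<open>Common reduction: \<open>S\<close> will be
    \<open>RX \<iota> U \<sigma> V r\<close> or the whole rank constraint set, and only the sign of
    the Lagrangian gradient on \<open>S\<close> remains to be checked.\<close>
  have min: "strict_local_minimizer f (affine_constraints l A b \<inter> S) X"
    if "X \<in> S" "S \<subseteq> low_rank_matrices r"
      and S: "\<And>Z. Z \<in> S \<Longrightarrow> 0 \<le> (gradient f X + (\<Sum>i=1..l. y i *\<^sub>R A i)) \<bullet> (Z - X)" for S
  proof (rule second_order_sufficient[OF has_derivative_gradient[OF diff] H])
    show "X \<in> affine_constraints l A b \<inter> S"
      using assms(5) that by blast
    show "0 \<le> gradient f X \<bullet> (Z - X)" if Z: "Z \<in> affine_constraints l A b \<inter> S" for Z
    proof -
      \<comment> \<open>Both points satisfy the same equations, so each \<open>A i\<close> is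
        orthogonal to their difference.\<close>
      have "(\<Sum>i=1..l. y i *\<^sub>R A i) \<bullet> (Z - X) = 0"
        using Z assms(5) by (auto simp: inner_sum_left inner_diff_right affine_constraints_def)
      then show ?thesis
        using S[of Z] Z by (simp add: inner_add_left)
    qed
    fix \<Xi> assume "\<Xi> \<in> bouligand_tangent_cone (affine_constraints l A b \<inter> S) X" "\<Xi> \<noteq> 0"
    then have "0 < hessian f X \<Xi> \<Xi>"
      using assms(8) \<open>S \<subseteq> low_rank_matrices r\<close>
        bouligand_tangent_cone_mono[of "affine_constraints l A b \<inter> S" "affine_constraints l A b" X]
        bouligand_tangent_cone_mono[of "affine_constraints l A b \<inter> S" "low_rank_matrices r" X]
      by blast
    then show "0 < H X \<Xi> \<bullet> \<Xi>"
      by (simp add: hess)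
  qed
  {
    assume "rank X = r"
    have XJ: "X \<in> RXJ \<iota> U V J" if "{j. \<sigma> j \<noteq> 0} \<subseteq> J" for J
      using svd_in_RXJ assms(7) that .
    \<comment> \<open>\<open>RX\<close> is a union over such \<open>J\<close>, so one must exist;
      the support has at most \<open>r\<close> elements and \<open>r < CARD('n)\<close>.\<close>
    obtain J where "{j. \<sigma> j \<noteq> 0} \<subseteq> J" "card J = r"
      using exists_subset_between[of "{j. \<sigma> j \<noteq> 0}" r UNIV] svd_card_le_rank[OF assms(7)]
        \<open>rank X = r\<close> assms(3) by auto
    then have X: "X \<in> RX \<iota> U \<sigma> V r"
      using XJ unfolding RX_def by blast
    have low: "RX \<iota> U \<sigma> V r \<subseteq> low_rank_matrices r"
      by (auto simp: RX_def low_rank_matrices_def dest: rank_RXJ_le)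
    show "strict_local_minimizer f (affine_constraints l A b \<inter> RX \<iota> U \<sigma> V r) X"
    proof (rule min[OF X low])
      fix Z assume "Z \<in> RX \<iota> U \<sigma> V r"
      then obtain J where J: "card J = r" "{j. \<sigma> j \<noteq> 0} \<subseteq> J" "Z \<in> RXJ \<iota> U V J"
        unfolding RX_def by blast
      \<comment> \<open>\<open>X\<close> lies in every piece, in particular in the one containing
        \<open>Z\<close>, so the whole line through both stays in that piece.\<close>
      have "X + t *\<^sub>R (Z - X) \<in> RXJ \<iota> U V J" for t
        using J XJ by (intro subspace_add subspace_scale subspace_diff subspace_RXJ) auto
      then have "X + t *\<^sub>R (Z - X) \<in> low_rank_matrices r" for t
        using J(1) rank_RXJ_le unfolding low_rank_matrices_def by blast
      then have "Z - X \<in> bouligand_tangent_cone (low_rank_matrices r) X"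
        by (rule bouligand_tangent_cone_ray)
      then have "- (gradient f X + (\<Sum>i=1..l. y i *\<^sub>R A i)) \<bullet> (Z - X) \<le> 0"
        using normal unfolding frechet_normal_cone_def polar_cone_def by blast
      then show "0 \<le> (gradient f X + (\<Sum>i=1..l. y i *\<^sub>R A i)) \<bullet> (Z - X)"
        unfolding inner_minus_left by linarith
    qed
  next
    assume "rank X < r"
    then have "gradient f X + (\<Sum>i=1..l. y i *\<^sub>R A i) = 0"
      using frechet_normal_cone_low_rank_matrices[OF _ normal] by (metis neg_equal_0_iff_equal)
    \<comment> \<open>With the Lagrangian gradient zero, the sign condition is an equality.\<close>
    then show "strict_local_minimizer f (affine_constraints l A b \<inter> low_rank_matrices r) X"
      using assms(5) by (intro min) auto
  }
qed

end
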